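(* Let $\mathfrak{d}$ be the $4$-dimensional complex diamond Lie algebra with basis $e_1,\dots,e_4$ and brackets $[e_1,e_2]=e_3$, $[e_1,e_3]=-e_2$, $[e_2,e_3]=e_4$ (extended skew-symmetrically, all other brackets zero). Then $\mathfrak{d}$ has Leibniz deformations to $\mathfrak{sl}(2,\mathbb{C})\oplus\mathbb{C}$ and to $\mathfrak{L}_2$, where $\mathfrak{L}_2$ is the $4$-dimensional Leibniz algebra with basis $e_1,\dots,e_4$ and nonzero brackets $[e_1,e_2]=e_3=-[e_2,e_1]$, $[e_1,e_4]=e_1=-[e_4,e_1]$, $[e_4,e_2]=e_2=-[e_2,e_4]$, $[e_4,e_4]=e_3$.
   Context: All algebras are over $\mathbb{C}$. A left (resp. right) Leibniz algebra is a vector space $\mathfrak{L}$ with a bilinear bracket satisfying $[x,[y,z]]=[[x,y],z]+[y,[x,z]]$ (resp. $[x,[y,z]]=[[x,y],z]-[[x,z],y]$); a Leibniz algebra is one or the other. Lie algebras are Leibniz algebras. A (formal $1$-parameter, Leibniz) deformation of $(\mathfrak{L},\mu_0)$ is a Leibniz bracket $\mu_t=\mu_0+t\phi_1+t^2\phi_2+\cdots$ on $\mathfrak{L}\otimes\mathbb{C}[[t]]$, with $\phi_i$ bilinear maps $\mathfrak{L}\times\mathfrak{L}\to\mathfrak{L}$. $\mathfrak{L}$ has a deformation to (deforms to) a Leibniz algebra $\mathfrak{N}$ if there is a deformation $\mu_t$, polynomial in $t$, such that $(\mathfrak{L},\mu_t)\cong\mathfrak{N}$ for all nonzero $t$ near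 $0$. $\mathfrak{sl}(2,\mathbb{C})$ has brackets $[e_1,e_2]=e_3$, $[e_2,e_3]=2e_2$, $[e_1,e_3]=-2e_1$, and $\mathbb{C}$ is the $1$-dimensional abelian algebra. *)

theory Defs
  imports "HOL-Analysis.Analysis" "HOL-Computational_Algebra.Formal_Power_Series"
begin

text \<open>
  The distribution has no type class of complex vector spaces, so the scalar multiplication is an
  explicit parameter \<open>s\<close>. Being a vector space over the complex numbers is part of
  \<^const>\<open>Vector_Spaces.linear\<close>.
\<close>

definition bilinear_bracket ::
  "(complex \<Rightarrow> 'a \<Rightarrow> 'a) \<Rightarrow> ('a \<Rightarrow> 'a \<Rightarrow> 'a::ab_group_add) \<Rightarrow> bool" where
  "bilinear_bracket s br \<longleftrightarrow>
     (\<forall>x. Vector_Spaces.linear s s (\<lambda>y. br x y)) \<and>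
     (\<forall>y. Vector_Spaces.linear s s (\<lambda>x. br x y))"

definition left_leibniz_identity :: "('a \<Rightarrow> 'a \<Rightarrow> 'a::ab_group_add) \<Rightarrow> bool" where
  "left_leibniz_identity br \<longleftrightarrow>
     (\<forall>x y z. br x (br y z) = br (br x y) z + br y (br x z))"

definition right_leibniz_identity :: "('a \<Rightarrow> 'a \<Rightarrow> 'a::ab_group_add) \<Rightarrow> bool" where
  "right_leibniz_identity br \<longleftrightarrow>
     (\<forall>x y z. br x (br y z) = br (br x y) z - br (br x z) y)"

definition leibniz_algebra ::
  "(complex \<Rightarrow> 'a \<Rightarrow> 'a) \<Rightarrow> ('a \<Rightarrow> 'a \<Rightarrow> 'a::ab_group_add) \<Rightarrow> bool" where
  "leibniz_algebra s br \<longleftrightarrow>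
     bilinear_bracket s br \<and> (left_leibniz_identity br \<or> right_leibniz_identity br)"

definition leibniz_isomorphic ::
  "(complex \<Rightarrow> 'a \<Rightarrow> 'a) \<Rightarrow> ('a \<Rightarrow> 'a \<Rightarrow> 'a::ab_group_add) \<Rightarrow>
   (complex \<Rightarrow> 'b \<Rightarrow> 'b) \<Rightarrow> ('b \<Rightarrow> 'b \<Rightarrow> 'b::ab_group_add) \<Rightarrow> bool" where
  "leibniz_isomorphic s br s' br' \<longleftrightarrow>
     (\<exists>f. Vector_Spaces.linear s s' f \<and> bij f \<and> (\<forall>x y. f (br x y) = br' (f x) (f y)))"

text \<open>
  Elements of the scalar extension to formal power series are power series with coefficients in
  the algebra, of type \<open>'a fps\<close> (for a finite-dimensional algebra this is the tensor product with
  the power series ring). The bracket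
  \<open>\<phi>\<^sub>0 + t \<phi>\<^sub>1 + t\<^sup>2 \<phi>\<^sub>2 + \<dots>\<close> is extended bilinearly over power series, so its
  \<open>n\<close>-th coefficient at \<open>X, Y\<close> is the sum of \<open>\<phi>\<^sub>i(X\<^sub>j, Y\<^sub>k)\<close> over \<open>i + j + k = n\<close>.
\<close>

definition formal_bracket ::
  "(nat \<Rightarrow> 'a \<Rightarrow> 'a \<Rightarrow> 'a::ab_group_add) \<Rightarrow> 'a fps \<Rightarrow> 'a fps \<Rightarrow> 'a fps" where
  "formal_bracket \<phi> X Y =
     Abs_fps (\<lambda>n. \<Sum>i\<le>n. \<Sum>j\<le>n - i. \<phi> i (fps_nth X j) (fps_nth Y (n - i - j)))"

definition leibniz_deformation ::
  "(complex \<Rightarrow> 'a \<Rightarrow> 'a) \<Rightarrow> ('a \<Rightarrow> 'a \<Rightarrow> 'a::ab_group_add) \<Rightarrow>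
   (nat \<Rightarrow> 'a \<Rightarrow> 'a \<Rightarrow> 'a) \<Rightarrow> bool" where
  "leibniz_deformation s \<mu> \<phi> \<longleftrightarrow>
     leibniz_algebra s \<mu> \<and> \<phi> 0 = \<mu> \<and> (\<forall>i. bilinear_bracket s (\<phi> i)) \<and>
     (left_leibniz_identity (formal_bracket \<phi>) \<or> right_leibniz_identity (formal_bracket \<phi>))"

definition deforms_to ::
  "(complex \<Rightarrow> 'a \<Rightarrow> 'a) \<Rightarrow> ('a \<Rightarrow> 'a \<Rightarrow> 'a::ab_group_add) \<Rightarrow>
   (complex \<Rightarrow> 'b \<Rightarrow> 'b) \<Rightarrow> ('b \<Rightarrow> 'b \<Rightarrow> 'b::ab_group_add) \<Rightarrow> bool" where
  "deforms_to s \<mu> s' \<nu> \<longleftrightarrow>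
     leibniz_algebra s' \<nu> \<and>
     (\<exists>\<phi> N. leibniz_deformation s \<mu> \<phi> \<and> (\<forall>i>N. \<forall>x y. \<phi> i x y = 0) \<and>
        (\<forall>\<^sub>F t in at 0. leibniz_isomorphic s (\<lambda>x y. \<Sum>i\<le>N. s (t ^ i) (\<phi> i x y)) s' \<nu>))"

definition direct_sum_bracket ::
  "('a \<Rightarrow> 'a \<Rightarrow> 'a) \<Rightarrow> ('b \<Rightarrow> 'b \<Rightarrow> 'b) \<Rightarrow> 'a \<times> 'b \<Rightarrow> 'a \<times> 'b \<Rightarrow> 'a \<times> 'b" where
  "direct_sum_bracket br br' x y = (br (fst x) (fst y), br' (snd x) (snd y))"

text \<open>
  Brackets on coordinate spaces are the bilinear extensions of their values \<open>c i j\<close> at pairs of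
  standard basis vectors. The index \<open>4\<close> of type \<open>4\<close> equals \<open>0\<close>, so \<open>1, 2, 3, 4\<close> are the
  four distinct indices; likewise for type \<open>3\<close>.
\<close>

definition bracket_of_table ::
  "('n \<Rightarrow> 'n \<Rightarrow> complex ^ 'n) \<Rightarrow> complex ^ 'n \<Rightarrow> complex ^ 'n \<Rightarrow> complex ^ ('n::finite)" where
  "bracket_of_table c x y = (\<Sum>i\<in>UNIV. \<Sum>j\<in>UNIV. (x $ i * y $ j) *s c i j)"

abbreviation basis_vec :: "'n \<Rightarrow> complex ^ ('n::finite)" where
  "basis_vec i \<equiv> axis i 1"

definition diamond_bracket :: "complex ^ 4 \<Rightarrow> complex ^ 4 \<Rightarrow> complex ^ 4" where
  "diamond_bracket = bracket_of_table (\<lambda>i j.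
     if (i, j) = (1, 2) then basis_vec 3
     else if (i, j) = (2, 1) then - basis_vec 3
     else if (i, j) = (1, 3) then - basis_vec 2
     else if (i, j) = (3, 1) then basis_vec 2
     else if (i, j) = (2, 3) then basis_vec 4
     else if (i, j) = (3, 2) then - basis_vec 4
     else 0)"

definition sl2_bracket :: "complex ^ 3 \<Rightarrow> complex ^ 3 \<Rightarrow> complex ^ 3" where
  "sl2_bracket = bracket_of_table (\<lambda>i j.
     if (i, j) = (1, 2) then basis_vec 3
     else if (i, j) = (2, 1) then - basis_vec 3
     else if (i, j) = (2, 3) then 2 *s basis_vec 2
     else if (i, j) = (3, 2) then - (2 *s basis_vec 2)
     else if (i, j) = (1, 3) then - (2 *s basis_vec 1)
     else if (i, j) = (3, 1) then 2 *s basis_vec 1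
     else 0)"

definition L2_bracket :: "complex ^ 4 \<Rightarrow> complex ^ 4 \<Rightarrow> complex ^ 4" where
  "L2_bracket = bracket_of_table (\<lambda>i j.
     if (i, j) = (1, 2) then basis_vec 3
     else if (i, j) = (2, 1) then - basis_vec 3
     else if (i, j) = (1, 4) then basis_vec 1
     else if (i, j) = (4, 1) then - basis_vec 1
     else if (i, j) = (4, 2) then basis_vec 2
     else if (i, j) = (2, 4) then - basis_vec 2
     else if (i, j) = (4, 4) then basis_vec 3
     else 0)"

definition abelian_bracket :: "'a \<Rightarrow> 'a \<Rightarrow> 'a::zero" where
  "abelian_bracket x y = 0"

end

theory Submission
  imports Defs
begin

text \<open>
  Both deformations are of first order, \<open>\<mu>\<^sub>0 + t \<psi>\<close>, where \<open>\<psi>\<close> is a cocycle that is itself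
  a left Leibniz bracket.

  For \<open>sl(2) \<oplus> \<complex>\<close> deform \<open>[e\<^sub>2, e\<^sub>3]\<close> to \<open>e\<^sub>4 + t e\<^sub>1\<close>. If \<open>t\<close> is nonzero, then
  \<open>e\<^sub>1 + e\<^sub>4 / t, e\<^sub>2, e\<^sub>3\<close> span a form of \<open>so(3)\<close>, and \<open>e\<^sub>4\<close> is central.

  For \<open>L\<^sub>2\<close> deform \<open>[e\<^sub>1, e\<^sub>1]\<close> to \<open>t e\<^sub>4\<close>. The new basis consists of \<open>\<i> e\<^sub>1\<close>, of its
  eigenvectors proportional to \<open>e\<^sub>2 \<plusminus> \<i> e\<^sub>3\<close>, and of a multiple of \<open>e\<^sub>4\<close>, scaled to
  turn \<open>[\<i> e\<^sub>1, \<i> e\<^sub>1] = - t e\<^sub>4\<close> into the third basis vector.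
\<close>

section \<open>Formal brackets\<close>

lemma bilinear_bracketI:
  assumes "vector_space s"
    and "\<And>x y z. br (x + y) z = br x z + br y z"
    and "\<And>x y z. br x (y + z) = br x y + br x z"
    and "\<And>c x y. br (s c x) y = s c (br x y)"
    and "\<And>c x y. br x (s c y) = s c (br x y)"
  shows "bilinear_bracket s br"
  using assms unfolding bilinear_bracket_def Vector_Spaces.linear_iff by blast

lemma bilinear_bracketD:
  assumes "bilinear_bracket s br"
  shows "br (x + y) z = br x z + br y z"
    and "br x (y + z) = br x y + br x z"
    and "br (s c x) y = s c (br x y)"
    and "br x (s c y) = s c (br x y)"
    and "vector_space s"
  using assms unfolding bilinear_bracket_def Vector_Spaces.linear_iff by blast+

lemma finite_nat_triples: "finite {(i, j, k). i + j + k = (n::nat)}"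
  by (rule finite_subset[of _ "{..n} \<times> {..n} \<times> {..n}"]) auto

text \<open>Indexing by all triples of fixed total, rather than by nested ranges with subtraction,
  treats the three degrees alike, so iterated brackets can be compared by reindexing.\<close>

lemma formal_bracket_nth:
  "fps_nth (formal_bracket \<phi> X Y) n =
     (\<Sum>(i, j, k)\<in>{(i, j, k). i + j + k = n}. \<phi> i (fps_nth X j) (fps_nth Y k))"
proof -
  have "fps_nth (formal_bracket \<phi> X Y) n =
      (\<Sum>(i, j)\<in>Sigma {..n} (\<lambda>i. {..n - i}). \<phi> i (fps_nth X j) (fps_nth Y (n - i - j)))"
    by (simp add: formal_bracket_def sum.Sigma)
  also have "\<dots> = (\<Sum>(i, j, k)\<in>{(i, j, k). i + j + k = n}. \<phi> i (fps_nth X j) (fps_nth Y k))"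
    by (rule sum.reindex_bij_witness[of _ "\<lambda>(i, j, k). (i, j)" "\<lambda>(i, j). (i, j, n - i - j)"]) auto
  finally show ?thesis .
qed

text \<open>By additivity each \<open>\<phi> i\<close> passes through the coefficient sums, so every
  iterated bracket becomes one sum over five degrees. For fixed degrees of the three series, what
  remains is the \<open>leib\<close> hypothesis at their coefficients.\<close>

lemma formal_bracket_left_leibniz:
  fixes \<phi> :: "nat \<Rightarrow> 'a \<Rightarrow> 'a \<Rightarrow> 'a::ab_group_add"
  assumes addl: "\<And>i x y z. \<phi> i (x + y) z = \<phi> i x z + \<phi> i y z"
    and addr: "\<And>i x y z. \<phi> i x (y + z) = \<phi> i x y + \<phi> i x z"
    and leib: "\<And>n x y z. (\<Sum>i\<le>n. \<phi> i x (\<phi> (n - i) y z)) =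
      (\<Sum>i\<le>n. \<phi> i (\<phi> (n - i) x y) z + \<phi> i y (\<phi> (n - i) x z))"
  shows "left_leibniz_identity (formal_bracket \<phi>)"
proof -
  let ?T = "\<lambda>n::nat. {(i, j, k). i + j + k = n}"
  \<comment> \<open>Here \<open>i\<close> and \<open>l\<close> are the degrees of the outer and
    inner \<open>\<phi>\<close>, while \<open>a\<close>, \<open>b\<close>, \<open>c\<close> are
    those of the three series. The degree \<open>m\<close> of the inner bracket is determined by
    these, hence absent.\<close>
  define Q where "Q n = {(i, l, a, b, c). i + l + a + b + c = n}" for n :: nat
  have l_sum: "\<phi> i (sum f A) y = (\<Sum>a\<in>A. \<phi> i (f a) y)" for i f y and A :: "(nat \<times> nat \<times> nat) set"
  proof -
    have "\<phi> i 0 y = 0" using addl[of i 0 0 y] by simp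
    then show ?thesis using sum_comp_morphism[of "\<lambda>x. \<phi> i x y" f A] addl by (simp add: o_def)
  qed
  have r_sum: "\<phi> i x (sum f A) = (\<Sum>a\<in>A. \<phi> i x (f a))" for i f x and A :: "(nat \<times> nat \<times> nat) set"
  proof -
    have "\<phi> i x 0 = 0" using addr[of i x 0 0] by simp
    then show ?thesis using sum_comp_morphism[of "\<phi> i x" f A] addr by (simp add: o_def)
  qed
  have right: "fps_nth (formal_bracket \<phi> X (formal_bracket \<phi> Y Z)) n =
      (\<Sum>(i, l, a, b, c)\<in>Q n. \<phi> i (fps_nth X a) (\<phi> l (fps_nth Y b) (fps_nth Z c)))" for X Y Z n
  proof -
    have "fps_nth (formal_bracket \<phi> X (formal_bracket \<phi> Y Z)) n =
        (\<Sum>((i, a, m), (l, b, c))\<in>Sigma (?T n) (\<lambda>(i, a, m). ?T m).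
          \<phi> i (fps_nth X a) (\<phi> l (fps_nth Y b) (fps_nth Z c)))"
      by (subst sum.Sigma[symmetric])
         (auto simp: formal_bracket_nth r_sum finite_nat_triples[unfolded case_prod_unfold] case_prod_unfold intro!: sum.cong)
    also have "\<dots> = (\<Sum>(i, l, a, b, c)\<in>Q n. \<phi> i (fps_nth X a) (\<phi> l (fps_nth Y b) (fps_nth Z c)))"
      by (rule sum.reindex_bij_witness[of _
            "\<lambda>(i, l, a, b, c). ((i, a, l + b + c), (l, b, c))"
            "\<lambda>((i, a, m), (l, b, c)). (i, l, a, b, c)"]) (auto simp: Q_def)
    finally show ?thesis .
  qed
  have left: "fps_nth (formal_bracket \<phi> (formal_bracket \<phi> X Y) Z) n =
      (\<Sum>(i, l, a, b, c)\<in>Q n. \<phi> i (\<phi> l (fps_nth X a) (fps_nth Y b)) (fps_nth Z c))" for X Y Z n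
  proof -
    have "fps_nth (formal_bracket \<phi> (formal_bracket \<phi> X Y) Z) n =
        (\<Sum>((i, m, c), (l, a, b))\<in>Sigma (?T n) (\<lambda>(i, m, c). ?T m).
          \<phi> i (\<phi> l (fps_nth X a) (fps_nth Y b)) (fps_nth Z c))"
      by (subst sum.Sigma[symmetric])
         (auto simp: formal_bracket_nth l_sum finite_nat_triples[unfolded case_prod_unfold] case_prod_unfold intro!: sum.cong)
    also have "\<dots> = (\<Sum>(i, l, a, b, c)\<in>Q n. \<phi> i (\<phi> l (fps_nth X a) (fps_nth Y b)) (fps_nth Z c))"
      by (rule sum.reindex_bij_witness[of _
            "\<lambda>(i, l, a, b, c). ((i, l + a + b, c), (l, a, b))"
            "\<lambda>((i, m, c), (l, a, b)). (i, l, a, b, c)"]) (auto simp: Q_def)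
    finally show ?thesis .
  qed
  \<comment> \<open>In the term with \<open>Y\<close> outermost, \<open>right\<close> lists the
    degree of \<open>Y\<close> before that of \<open>X\<close>; exchanging the names aligns it with
    the other two terms.\<close>
  have swap: "(\<Sum>(i, l, a, b, c)\<in>Q n. f i l a b c) = (\<Sum>(i, l, a, b, c)\<in>Q n. f i l b a c)"
    for f :: "nat \<Rightarrow> nat \<Rightarrow> nat \<Rightarrow> nat \<Rightarrow> nat \<Rightarrow> 'a" and n
    by (rule sum.reindex_bij_witness[of _
          "\<lambda>(i, l, a, b, c). (i, l, b, a, c)" "\<lambda>(i, l, a, b, c). (i, l, b, a, c)"]) (auto simp: Q_def)
  \<comment> \<open>Collecting by \<open>p = i + l\<close> isolates the part of degree
    \<open>p\<close> in the structure maps, which is the shape of \<open>leib\<close>.\<close>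
  have group: "(\<Sum>(i, l, a, b, c)\<in>Q n. f i l a b c) =
      (\<Sum>(p, a, b, c)\<in>{(p, a, b, c). p + a + b + c = n}. \<Sum>i\<le>p. f i (p - i) a b c)"
    for f :: "nat \<Rightarrow> nat \<Rightarrow> nat \<Rightarrow> nat \<Rightarrow> nat \<Rightarrow> 'a" and n
  proof -
    have "finite {(p, a, b, c). p + a + b + c = n}"
      by (rule finite_subset[of _ "{..n} \<times> {..n} \<times> {..n} \<times> {..n}"]) auto
    then have "(\<Sum>(p, a, b, c)\<in>{(p, a, b, c). p + a + b + c = n}. \<Sum>i\<le>p. f i (p - i) a b c) =
        (\<Sum>((p, a, b, c), i)\<in>Sigma {(p, a, b, c). p + a + b + c = n} (\<lambda>(p, a, b, c). {..p}).
          f i (p - i) a b c)"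
      by (subst sum.Sigma[symmetric]) (auto simp: case_prod_unfold)
    also have "\<dots> = (\<Sum>(i, l, a, b, c)\<in>Q n. f i l a b c)"
      by (rule sum.reindex_bij_witness[of _
            "\<lambda>(i, l, a, b, c). ((i + l, a, b, c), i)"
            "\<lambda>((p, a, b, c), i). (i, p - i, a, b, c)"]) (auto simp: Q_def)
    finally show ?thesis ..
  qed
  show ?thesis
    unfolding left_leibniz_identity_def
  proof (intro allI fps_ext)
    fix X Y Z :: "'a fps" and n
    let ?x = "fps_nth X" and ?y = "fps_nth Y" and ?z = "fps_nth Z"
    have "fps_nth (formal_bracket \<phi> (formal_bracket \<phi> X Y) Z + formal_bracket \<phi> Y (formal_bracket \<phi> X Z)) n
      = (\<Sum>(i, l, a, b, c)\<in>Q n. \<phi> i (\<phi> l (?x a) (?y b)) (?z c) + \<phi> i (?y b) (\<phi> l (?x a) (?z c)))"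
      using swap[of "\<lambda>i l a b c. \<phi> i (?y a) (\<phi> l (?x b) (?z c))" n]
      by (simp add: left right sum.distrib case_prod_unfold)
    also have "\<dots> = (\<Sum>(i, l, a, b, c)\<in>Q n. \<phi> i (?x a) (\<phi> l (?y b) (?z c)))"
      unfolding group leib ..
    finally show "fps_nth (formal_bracket \<phi> X (formal_bracket \<phi> Y Z)) n =
      fps_nth (formal_bracket \<phi> (formal_bracket \<phi> X Y) Z + formal_bracket \<phi> Y (formal_bracket \<phi> X Z)) n"
      by (simp add: right)
  qed
qed

text \<open>In the Leibniz identity for \<open>\<mu> + t \<psi>\<close>, the coefficients of degree
  0, 1 and 2 in \<open>t\<close> are the identity for \<open>\<mu>\<close>, the cocycle condition
  and the identity for \<open>\<psi>\<close>; there are no higher ones.\<close>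

lemma deforms_to_first_order:
  assumes mu: "bilinear_bracket s \<mu>" "left_leibniz_identity \<mu>"
    and psi: "bilinear_bracket s \<psi>" "left_leibniz_identity \<psi>"
    and cocycle: "\<And>x y z. \<mu> x (\<psi> y z) + \<psi> x (\<mu> y z) =
      \<mu> (\<psi> x y) z + \<psi> (\<mu> x y) z + \<mu> y (\<psi> x z) + \<psi> y (\<mu> x z)"
    and nu: "leibniz_algebra s' \<nu>"
    and iso: "\<And>t. t \<noteq> 0 \<Longrightarrow> leibniz_isomorphic s (\<lambda>x y. \<mu> x y + s t (\<psi> x y)) s' \<nu>"
  shows "deforms_to s \<mu> s' \<nu>"
proof -
  interpret vector_space s by (rule bilinear_bracketD(5)[OF mu(1)])
  define \<phi> where "\<phi> i = (if i = 0 then \<mu> else if i = 1 then \<psi> else (\<lambda>x y. 0))" for i :: nat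
  have leib: "\<mu> x (\<mu> y z) = \<mu> (\<mu> x y) z + \<mu> y (\<mu> x z)"
    "\<psi> x (\<psi> y z) = \<psi> (\<psi> x y) z + \<psi> y (\<psi> x z)" for x y z
    using mu(2) psi(2) unfolding left_leibniz_identity_def by blast+
  have phi_simps: "\<phi> 0 = \<mu>" "\<phi> (Suc 0) = \<psi>" "\<And>i x y. i > 1 \<Longrightarrow> \<phi> i x y = 0"
    by (auto simp: \<phi>_def)
  have bil: "bilinear_bracket s (\<phi> i)" for i
    unfolding \<phi>_def using mu psi by (auto intro!: bilinear_bracketI vector_space_axioms)
  have phi_0: "\<phi> i x 0 = 0" "\<phi> i 0 x = 0" for i x
    using bilinear_bracketD(1,2)[OF bil[of i], of 0 0 x] bilinear_bracketD(1,2)[OF bil[of i], of x 0 0]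
    by auto
  \<comment> \<open>For \<open>n > 2\<close>, one of \<open>i\<close> and \<open>n - i\<close>
    exceeds 1, so one of the two composed maps is zero.\<close>
  have vanish: "\<phi> i x (\<phi> (n - i) y z) = 0" "\<phi> i (\<phi> (n - i) y z) x = 0" if "n > 2" for i n x y z
    using that phi_simps(3)[of i] phi_simps(3)[of "n - i"]
    by (cases "i > 1"; force simp: phi_0)+
  have "left_leibniz_identity (formal_bracket \<phi>)"
  proof (rule formal_bracket_left_leibniz)
    fix n :: nat and x y z
    consider "n = 0" | "n = 1" | "n = 2" | "n > 2" by linarith
    then show "(\<Sum>i\<le>n. \<phi> i x (\<phi> (n - i) y z)) =
      (\<Sum>i\<le>n. \<phi> i (\<phi> (n - i) x y) z + \<phi> i y (\<phi> (n - i) x z))"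
    proof cases
      case 1
      then show ?thesis using leib(1)[of x y z] by (simp add: phi_simps)
    next
      case 2
      then show ?thesis using cocycle[of x y z] by (simp add: phi_simps add_ac)
    next
      \<comment> \<open>Only \<open>i = 1\<close> survives: the other two terms involve
        \<open>\<phi> 2 = 0\<close>, either outside or as a zero argument.\<close>
      case 3
      then show ?thesis
        using leib(2)[of x y z] phi_0[of 0] by (simp add: numeral_2_eq_2 phi_simps phi_0)
    next
      case 4
      then show ?thesis by (simp add: vanish)
    qed
  qed (use bilinear_bracketD[OF bil] in blast)+
  then have "leibniz_deformation s \<mu> \<phi>"
    using mu bil by (simp add: leibniz_deformation_def leibniz_algebra_def phi_simps)
  moreover have "\<forall>\<^sub>F t in at 0. leibniz_isomorphic s (\<lambda>x y. \<Sum>i\<le>1. s (t ^ i) (\<phi> i x y)) s' \<nu>"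
    using eventually_neq_at_within[of 0 0 UNIV]
    by eventually_elim (use iso in \<open>simp add: phi_simps\<close>)
  ultimately show ?thesis
    unfolding deforms_to_def using nu phi_simps(3) by blast
qed

lemma leibniz_isomorphicI:
  assumes "Vector_Spaces.linear s s' f" "\<And>x. g (f x) = x" "\<And>y. f (g y) = y"
    and "\<And>x y. f (br x y) = br' (f x) (f y)"
  shows "leibniz_isomorphic s br s' br'"
  unfolding leibniz_isomorphic_def using assms by (metis bijI')

section \<open>The brackets in coordinates\<close>

lemma bilinear_bracket_of_table: "bilinear_bracket (*s) (bracket_of_table c)"
  by (rule bilinear_bracketI)
     (simp_all add: vec.vector_space_axioms bracket_of_table_def vec.scale_sum_right sum.distrib
        vec.scale_left_distrib distrib_left distrib_right mult_ac)

text \<open>Coordinate formulas turn the bracket identities below into polynomial identities in the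
  entries of the vectors.\<close>

lemma diamond_bracket_nth:
  "diamond_bracket x y $ 1 = 0"
  "diamond_bracket x y $ 2 = x $ 3 * y $ 1 - x $ 1 * y $ 3"
  "diamond_bracket x y $ 3 = x $ 1 * y $ 2 - x $ 2 * y $ 1"
  "diamond_bracket x y $ 4 = x $ 2 * y $ 3 - x $ 3 * y $ 2"
  by (simp_all add: diamond_bracket_def bracket_of_table_def sum_4 axis_def)

lemma sl2_bracket_nth:
  "sl2_bracket x y $ 1 = 2 * (x $ 3 * y $ 1 - x $ 1 * y $ 3)"
  "sl2_bracket x y $ 2 = 2 * (x $ 2 * y $ 3 - x $ 3 * y $ 2)"
  "sl2_bracket x y $ 3 = x $ 1 * y $ 2 - x $ 2 * y $ 1"
  by (simp_all add: sl2_bracket_def bracket_of_table_def sum_3 axis_def algebra_simps)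

lemma L2_bracket_nth:
  "L2_bracket x y $ 1 = x $ 1 * y $ 4 - x $ 4 * y $ 1"
  "L2_bracket x y $ 2 = x $ 4 * y $ 2 - x $ 2 * y $ 4"
  "L2_bracket x y $ 3 = x $ 1 * y $ 2 - x $ 2 * y $ 1 + x $ 4 * y $ 4"
  "L2_bracket x y $ 4 = 0"
  by (simp_all add: L2_bracket_def bracket_of_table_def sum_4 axis_def)

lemma bilinear_diamond: "bilinear_bracket (*s) diamond_bracket"
  unfolding diamond_bracket_def by (rule bilinear_bracket_of_table)

lemma left_leibniz_diamond: "left_leibniz_identity diamond_bracket"
  by (simp add: left_leibniz_identity_def vec_eq_iff forall_4 diamond_bracket_nth algebra_simps)

lemma leibniz_algebra_L2: "leibniz_algebra (*s) L2_bracket"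
proof -
  have "left_leibniz_identity L2_bracket"
    by (simp add: left_leibniz_identity_def vec_eq_iff forall_4 L2_bracket_nth algebra_simps)
  then show ?thesis
    using bilinear_bracket_of_table unfolding leibniz_algebra_def L2_bracket_def by blast
qed

text \<open>Regards the complex numbers as a vector space over themselves, which supplies the vector
  space laws of the direct sum.\<close>

interpretation sl2_plus_C: vector_space_prod "(*s) :: complex \<Rightarrow> complex ^ 3 \<Rightarrow> _" "(*) :: complex \<Rightarrow> _"
  by unfold_locales (simp_all add: algebra_simps)

lemma leibniz_algebra_sl2_plus_C:
  "leibniz_algebra (module_prod.scale (*s) ((*) :: complex \<Rightarrow> complex \<Rightarrow> complex))
     (direct_sum_bracket sl2_bracket abelian_bracket)"
proof -
  have bil: "bilinear_bracket (*s) sl2_bracket"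
    unfolding sl2_bracket_def by (rule bilinear_bracket_of_table)
  have "bilinear_bracket (module_prod.scale (*s) ((*) :: complex \<Rightarrow> complex \<Rightarrow> complex))
     (direct_sum_bracket sl2_bracket abelian_bracket)"
    by (rule bilinear_bracketI)
       (simp_all add: sl2_plus_C.p.vector_space_axioms direct_sum_bracket_def abelian_bracket_def
          sl2_plus_C.scale_def bilinear_bracketD[OF bil])
  moreover have "left_leibniz_identity (direct_sum_bracket sl2_bracket (abelian_bracket :: complex \<Rightarrow> _))"
    by (simp add: left_leibniz_identity_def direct_sum_bracket_def abelian_bracket_def
        vec_eq_iff forall_3 sl2_bracket_nth algebra_simps)
  ultimately show ?thesis unfolding leibniz_algebra_def by blast
qed

section \<open>The two deformations\<close>

lemma diamond_deforms_to_sl2_plus_C: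
  "deforms_to (*s) diamond_bracket
     (module_prod.scale (*s) ((*) :: complex \<Rightarrow> complex \<Rightarrow> complex))
     (direct_sum_bracket sl2_bracket abelian_bracket)"
proof -
  \<comment> \<open>This is a Heisenberg bracket: its values are multiples of \<open>e1\<close>,
    which it annihilates, so all its double brackets vanish.\<close>
  define \<psi> :: "complex ^ 4 \<Rightarrow> complex ^ 4 \<Rightarrow> complex ^ 4"
    where "\<psi> x y = (x $ 2 * y $ 3 - x $ 3 * y $ 2) *s basis_vec 1" for x y
  have psi_nth: "\<psi> x y $ 1 = x $ 2 * y $ 3 - x $ 3 * y $ 2"
    "\<psi> x y $ 2 = 0" "\<psi> x y $ 3 = 0" "\<psi> x y $ 4 = 0" for x y
    by (simp_all add: \<psi>_def axis_def)
  show ?thesis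
  proof (rule deforms_to_first_order[OF bilinear_diamond left_leibniz_diamond])
    show "bilinear_bracket (*s) \<psi>"
      by (rule bilinear_bracketI)
         (simp_all add: vec.vector_space_axioms vec_eq_iff forall_4 psi_nth algebra_simps)
    show "left_leibniz_identity \<psi>"
      by (simp add: left_leibniz_identity_def vec_eq_iff forall_4 psi_nth)
    show "diamond_bracket x (\<psi> y z) + \<psi> x (diamond_bracket y z) =
        diamond_bracket (\<psi> x y) z + \<psi> (diamond_bracket x y) z +
        diamond_bracket y (\<psi> x z) + \<psi> y (diamond_bracket x z)" for x y z
      by (simp add: vec_eq_iff forall_4 psi_nth diamond_bracket_nth algebra_simps)
    fix t :: complex assume t: "t \<noteq> 0"
    \<comment> \<open>\<open>f\<close> reads off coordinates in the basis given by \<open>g\<close>;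
      the term \<open>- x $ 1 / t\<close> comes from \<open>e1 = (e1 + e4/t) - e4/t\<close>.\<close>
    define f :: "complex ^ 4 \<Rightarrow> (complex ^ 3) \<times> complex" where
      "f x = (vector [(x $ 2 - \<i> * x $ 3) / 2, - t * (x $ 2 + \<i> * x $ 3) / 2, - \<i> / 2 * x $ 1],
        x $ 4 - x $ 1 / t)" for x
    \<comment> \<open>The \<open>sl(2)\<close> basis goes to \<open>e2 + \<i> e3\<close>,
      \<open>-(e2 - \<i> e3)/t\<close> and \<open>2 \<i> (e1 + e4/t)\<close>. The factor
      \<open>2 \<i>\<close> turns the eigenvalues of \<open>e1\<close>, which are \<i> and -\<i>,
      into 2 and -2; the factor \<open>-1/t\<close> then gives the first two vectors the third as
      bracket.\<close>
    define g :: "(complex ^ 3) \<times> complex \<Rightarrow> complex ^ 4" where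
      "g p = (case p of (u, c) \<Rightarrow> (2 * \<i> * u $ 3) *s basis_vec 1 +
        (u $ 1 - u $ 2 / t) *s basis_vec 2 + (\<i> * (u $ 1 + u $ 2 / t)) *s basis_vec 3 +
        (c + 2 * \<i> * u $ 3 / t) *s basis_vec 4)" for p
    show "leibniz_isomorphic (*s) (\<lambda>x y. diamond_bracket x y + t *s \<psi> x y)
        (module_prod.scale (*s) (*)) (direct_sum_bracket sl2_bracket abelian_bracket)"
    proof (rule leibniz_isomorphicI[where f = f and g = g])
      show "Vector_Spaces.linear (*s) (module_prod.scale (*s) (*)) f"
        unfolding Vector_Spaces.linear_iff
        by (auto simp: vec.vector_space_axioms sl2_plus_C.p.vector_space_axioms f_def
            sl2_plus_C.scale_def vec_eq_iff forall_3 algebra_simps add_divide_distrib diff_divide_distrib)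
      show "g (f x) = x" for x
        using t by (simp add: g_def f_def vec_eq_iff forall_4 axis_def field_simps)
      show "f (g y) = y" for y
        using t by (cases y) (simp add: g_def f_def vec_eq_iff forall_3 axis_def field_simps)
      show "f (diamond_bracket x y + t *s \<psi> x y) =
          direct_sum_bracket sl2_bracket abelian_bracket (f x) (f y)" for x y
        using t by (simp add: f_def direct_sum_bracket_def abelian_bracket_def vec_eq_iff forall_3
            sl2_bracket_nth diamond_bracket_nth psi_nth field_simps)
    qed
  qed (rule leibniz_algebra_sl2_plus_C)
qed

lemma diamond_deforms_to_L2: "deforms_to (*s) diamond_bracket (*s) L2_bracket"
proof -
  define \<psi> :: "complex ^ 4 \<Rightarrow> complex ^ 4 \<Rightarrow> complex ^ 4"
    where "\<psi> x y = (x $ 1 * y $ 1) *s basis_vec 4" for x y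
  have psi_nth: "\<psi> x y $ 4 = x $ 1 * y $ 1"
    "\<psi> x y $ 1 = 0" "\<psi> x y $ 2 = 0" "\<psi> x y $ 3 = 0" for x y
    by (simp_all add: \<psi>_def axis_def)
  show ?thesis
  proof (rule deforms_to_first_order[OF bilinear_diamond left_leibniz_diamond])
    show "bilinear_bracket (*s) \<psi>"
      by (rule bilinear_bracketI)
         (simp_all add: vec.vector_space_axioms vec_eq_iff forall_4 psi_nth algebra_simps)
    show "left_leibniz_identity \<psi>"
      by (simp add: left_leibniz_identity_def vec_eq_iff forall_4 psi_nth)
    \<comment> \<open>Every term is zero: \<open>\<psi>\<close> has values in the center, spanned by
      \<open>e4\<close>, and it sees only the \<open>e1\<close> coordinate, which is zero on all
      diamond brackets.\<close>
    show "diamond_bracket x (\<psi> y z) + \<psi> x (diamond_bracket y z) =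
        diamond_bracket (\<psi> x y) z + \<psi> (diamond_bracket x y) z +
        diamond_bracket y (\<psi> x z) + \<psi> y (diamond_bracket x z)" for x y z
      by (simp add: vec_eq_iff forall_4 psi_nth diamond_bracket_nth)
    fix t :: complex assume t: "t \<noteq> 0"
    define f :: "complex ^ 4 \<Rightarrow> complex ^ 4" where
      "f x = ((x $ 3 - \<i> * x $ 2) / t) *s basis_vec 1 + ((x $ 2 - \<i> * x $ 3) / 2) *s basis_vec 2 +
        (- x $ 4 / t) *s basis_vec 3 + (- \<i> * x $ 1) *s basis_vec 4" for x
    \<comment> \<open>The images of the basis are \<open>(t/2)(e3 + \<i> e2)\<close>,
      \<open>e2 + \<i> e3\<close>, \<open>-t e4\<close> and \<open>\<i> e1\<close>. The factor
      \<open>t/2\<close> makes the bracket of the first two equal to the square of the last, both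
      being \<open>-t e4\<close>.\<close>
    define g :: "complex ^ 4 \<Rightarrow> complex ^ 4" where
      "g y = (\<i> * y $ 4) *s basis_vec 1 + (y $ 2 + \<i> * t / 2 * y $ 1) *s basis_vec 2 +
        (\<i> * y $ 2 + t / 2 * y $ 1) *s basis_vec 3 + (- t * y $ 3) *s basis_vec 4" for y
    have f_nth: "f x $ 1 = (x $ 3 - \<i> * x $ 2) / t" "f x $ 2 = (x $ 2 - \<i> * x $ 3) / 2"
      "f x $ 3 = - x $ 4 / t" "f x $ 4 = - \<i> * x $ 1" for x
      by (simp_all add: f_def axis_def)
    have g_nth: "g y $ 1 = \<i> * y $ 4" "g y $ 2 = y $ 2 + \<i> * t / 2 * y $ 1"
      "g y $ 3 = \<i> * y $ 2 + t / 2 * y $ 1" "g y $ 4 = - t * y $ 3" for y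
      by (simp_all add: g_def axis_def)
    show "leibniz_isomorphic (*s) (\<lambda>x y. diamond_bracket x y + t *s \<psi> x y) (*s) L2_bracket"
    proof (rule leibniz_isomorphicI[where f = f and g = g])
      show "Vector_Spaces.linear (*s) (*s) f"
        unfolding Vector_Spaces.linear_iff using t
        by (auto simp: vec.vector_space_axioms vec_eq_iff forall_4 f_nth field_simps)
      show "g (f x) = x" for x
        using t by (simp add: vec_eq_iff forall_4 f_nth g_nth field_simps)
      show "f (g y) = y" for y
        using t by (simp add: vec_eq_iff forall_4 f_nth g_nth field_simps)
      show "f (diamond_bracket x y + t *s \<psi> x y) = L2_bracket (f x) (f y)" for x y
        using t by (simp add: vec_eq_iff forall_4 f_nth L2_bracket_nth diamond_bracket_nth
            psi_nth field_simps)
    qed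
  qed (rule leibniz_algebra_L2)
qed

theorem theorem4p2:
  shows "deforms_to (*s) diamond_bracket
           (module_prod.scale (*s) ((*) :: complex \<Rightarrow> complex \<Rightarrow> complex))
           (direct_sum_bracket sl2_bracket abelian_bracket)
       \<and> deforms_to (*s) diamond_bracket (*s) L2_bracket"
  using diamond_deforms_to_sl2_plus_C diamond_deforms_to_L2 ..

end
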